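(* Let $\ell$ be a positive integer. Whenever $$n\geq \left(2\ell+3\binom{\ell-1}{2}\right)\binom{\ell-1}{2}+\ell \;=\; \tfrac{3}{4}\ell^4+O(\ell^3),$$ every partial Steiner triple system on $n$ points has an $\ell$-good sequencing.
   Context: A partial Steiner triple system (PSTS) of order $n$ is a finite point set $V$ with $|V|=n$ together with a set of $3$-subsets of $V$, called blocks, any two distinct ones of which intersect in at most one element. A sequencing of $V$ is a sequence $x_1,x_2,\ldots,x_n$ in which every element of $V$ occurs exactly once. A segment of a sequence is a subsequence of consecutive entries. A sequencing is $\ell$-good if no segment of length at most $\ell$ contains (in its set of entries) all the points of a block. Convention: $\binom{0}{2}=\binom{1}{2}=0$. *)

theory Defs
  imports Complex_Main "HOL-Library.Sublist" "HOL-Library.Landau_Symbols"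
begin

definition partial_steiner_triple_system :: "nat \<Rightarrow> 'a set \<Rightarrow> 'a set set \<Rightarrow> bool" where
  "partial_steiner_triple_system n V Bs \<longleftrightarrow>
     finite V \<and> card V = n \<and>
     (\<forall>B\<in>Bs. B \<subseteq> V \<and> card B = 3) \<and>
     (\<forall>B\<in>Bs. \<forall>C\<in>Bs. B \<noteq> C \<longrightarrow> card (B \<inter> C) \<le> 1)"

definition sequencing :: "'a set \<Rightarrow> 'a list \<Rightarrow> bool" where
  "sequencing V xs \<longleftrightarrow> distinct xs \<and> set xs = V"

text \<open>Segments are contiguous, which is what \<^const>\<open>sublist\<close> (as opposed to
  \<^const>\<open>subseq\<close>) expresses.\<close>

definition good_sequencing :: "nat \<Rightarrow> 'a set \<Rightarrow> 'a set set \<Rightarrow> 'a list \<Rightarrow> bool" where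
  "good_sequencing l V Bs xs \<longleftrightarrow>
     sequencing V xs \<and>
     (\<forall>ys. sublist ys xs \<and> length ys \<le> l \<longrightarrow> \<not> (\<exists>B\<in>Bs. B \<subseteq> set ys))"

end

theory Submission
  imports Defs "HOL-Real_Asymp.Real_Asymp"
begin

text \<open>
Write \<open>m = (l - 1) choose 2\<close>. A sequencing can be built greedily from left to right: a point is
unsuitable for the next position only if it completes a block with two of the preceding \<open>l - 1\<close>
points, and two points have at most one block in common, so at most \<open>m\<close> points are unsuitable
(\<open>card_bad_next\<close>). The greedy process can therefore only get stuck when at most \<open>m\<close> points remain,
and the whole difficulty is to find room for the last \<open>m\<close> points.

The room is reserved in advance. The \<open>m\<close> positions \<open>0, l, \<dots>, (m - 1) l\<close> are left
empty at first. No segment of length \<open>l\<close> contains two of these gaps, so whether a point may go into a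
gap depends only on the points at ordinary positions around it, all of which lie below \<open>m l\<close>. Around
a gap there are at most \<open>3 m\<close> pairs of positions that share a segment of length \<open>l\<close> with it, at
most \<open>m\<close> for each of the three possible relative orders (\<open>card_near_pairs\<close>). Hence, once the positions below \<open>m l\<close> are
filled, the set \<open>B\<close> of points that are unsuitable for at least one gap is determined and has at most
\<open>3 m\<^sup>2\<close> elements. If every point of \<open>B\<close> is put at an ordinary position, then the \<open>m\<close> points left
at the end are suitable for every gap, and any bijection between them and the gaps finishes the
sequencing.

It remains to use up \<open>B\<close> early (\<open>absorb\<close>). While more than \<open>m\<close> points of \<open>B\<close> are unused, one
of them is suitable for the next position. Once at most \<open>m\<close> are left, each can be forced in at the
price of \<open>l - 1\<close> points outside \<open>B\<close>: these are chosen so that no two of them form a block with the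
target point \<open>b\<close>, after which \<open>b\<close> itself is suitable (\<open>fill_avoiding\<close>). This costs at most
\<open>m (l - 1)\<close> points outside \<open>B\<close>. The hypothesis on \<open>n\<close> guarantees at least \<open>m l + m + l\<close> such
points after the first \<open>m l\<close> positions, which is enough both for that and for leaving \<open>m\<close> points
for the gaps.
\<close>

section \<open>Counting nearby pairs of positions\<close>

text \<open>Pairs of positions that lie in a common segment of length \<open>l\<close> with \<open>p\<close>: three positions do so
iff their pairwise distances are less than \<open>l\<close>.\<close>

definition near_pairs :: "nat \<Rightarrow> nat \<Rightarrow> (nat \<times> nat) set" where
  "near_pairs l p =
     {(i, j). i < j \<and> i \<noteq> p \<and> j \<noteq> p \<and> j < i + l \<and> j < p + l \<and> p < i + l}"

text \<open>Three positions in a segment of length \<open>l\<close>, one of them fixed together with its rank among the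
three, are determined by the two distances from the leftmost or the rightmost one, that is, by a
2-subset of \<open>{1..<l}\<close>. The lemma turns such an encoding into a bound.\<close>

lemma card_le_offset_pairs:
  assumes "inj_on h S" and "h ` S \<subseteq> {(a, b). 0 < a \<and> a < b \<and> b < (l::nat)}"
  shows "finite S \<and> card S \<le> (l - 1) choose 2"
proof -
  let ?O = "{(a, b). 0 < a \<and> a < b \<and> b < (l::nat)}"
  have "?O \<subseteq> {..<l} \<times> {..<l}" by auto
  then have fin: "finite ?O" by (rule finite_subset) simp
  have "inj_on (\<lambda>(a, b). {a, b}) ?O"
    by (auto simp: inj_on_def doubleton_eq_iff)
  moreover have "(\<lambda>(a, b). {a, b}) ` ?O \<subseteq> {X. X \<subseteq> {1..<l} \<and> card X = 2}"
    by auto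
  ultimately have "card ?O \<le> card {X. X \<subseteq> {1..<l} \<and> card X = 2}"
    by (rule card_inj_on_le) simp
  also have "\<dots> = (l - 1) choose 2"
    by (simp add: n_subsets)
  finally have "card ?O \<le> (l - 1) choose 2" .
  moreover have "card S \<le> card ?O"
    using assms fin by (intro card_inj_on_le)
  moreover have "finite S"
    using assms fin inj_on_finite by blast
  ultimately show ?thesis by simp
qed

lemma near_pairs_before:
  "finite (near_pairs l p \<inter> {..<p} \<times> {..<p}) \<and>
   card (near_pairs l p \<inter> {..<p} \<times> {..<p}) \<le> (l - 1) choose 2"
  by (rule card_le_offset_pairs[where h = "\<lambda>(i, j). (p - j, p - i)"])
    (auto simp: inj_on_def near_pairs_def)

lemma card_near_pairs:
  "finite (near_pairs l p) \<and> card (near_pairs l p) \<le> 3 * ((l - 1) choose 2)"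
proof -
  \<comment> \<open>The three sets collect the pairs for which \<open>p\<close> comes last, in the middle, and first.\<close>
  let ?A = "near_pairs l p \<inter> {..<p} \<times> {..<p}"
  let ?B = "near_pairs l p \<inter> {..<p} \<times> {p<..}"
  let ?C = "near_pairs l p \<inter> {p<..} \<times> {p<..}"
  have B: "finite ?B \<and> card ?B \<le> (l - 1) choose 2"
    by (rule card_le_offset_pairs[where h = "\<lambda>(i, j). (p - i, j - i)"])
      (auto simp: inj_on_def near_pairs_def)
  have C: "finite ?C \<and> card ?C \<le> (l - 1) choose 2"
    by (rule card_le_offset_pairs[where h = "\<lambda>(i, j). (i - p, j - p)"])
      (auto simp: inj_on_def near_pairs_def)
  have eq: "near_pairs l p = ?A \<union> ?B \<union> ?C"
    by (auto simp: near_pairs_def)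
  have "card (?A \<union> ?B \<union> ?C) \<le> card ?A + card ?B + card ?C"
    by (meson add_right_mono card_Un_le order_trans)
  then have "card (near_pairs l p) \<le> 3 * ((l - 1) choose 2)"
    unfolding eq[symmetric] using near_pairs_before[of l p] B C by linarith
  moreover have "finite (?A \<union> ?B \<union> ?C)"
    using near_pairs_before[of l p] B C by blast
  ultimately show ?thesis unfolding eq[symmetric] by blast
qed

section \<open>Gaps and partial placements\<close>

text \<open>Spacing \<open>l\<close> is the least one for which no segment of length \<open>l\<close> contains two gaps.\<close>

definition gaps :: "nat \<Rightarrow> nat set" where
  "gaps l = (\<lambda>k. k * l) ` {..<(l - 1) choose 2}"

definition nongaps :: "nat \<Rightarrow> nat \<Rightarrow> nat set" where
  "nongaps l p = {..<p} - gaps l"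

lemma gap_window: "g \<in> gaps l \<Longrightarrow> g + l \<le> ((l - 1) choose 2) * l"
proof -
  assume "g \<in> gaps l"
  then obtain k where k: "g = k * l" "k < (l - 1) choose 2" by (auto simp: gaps_def)
  then have "Suc k * l \<le> ((l - 1) choose 2) * l" by (intro mult_le_mono1) simp
  then show ?thesis using k by simp
qed

lemma gaps_far_apart:
  assumes "g \<in> gaps l" "h \<in> gaps l" "g < h"
  shows "g + l \<le> h"
proof -
  obtain a b where ab: "g = a * l" "h = b * l" using assms by (auto simp: gaps_def)
  then have "Suc a \<le> b" using assms(3) by (metis mult_le_mono1 not_less not_less_eq_eq)
  then have "Suc a * l \<le> b * l" by (rule mult_le_mono1)
  then show ?thesis using ab by simp
qed

lemma finite_gaps: "finite (gaps l)"
  by (simp add: gaps_def)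

lemma card_gaps: "l \<ge> 1 \<Longrightarrow> card (gaps l) = (l - 1) choose 2"
  by (simp add: gaps_def card_image inj_on_def)

lemma gaps_less: "l \<ge> 1 \<Longrightarrow> g \<in> gaps l \<Longrightarrow> g < ((l - 1) choose 2) * l"
  using gap_window[of g l] by simp

lemma finite_nongaps: "finite (nongaps l p)"
  by (simp add: nongaps_def)

lemma nongaps_Suc: "p \<notin> gaps l \<Longrightarrow> nongaps l (Suc p) = insert p (nongaps l p)"
  by (auto simp: nongaps_def)

lemma nongaps_Suc_gap: "p \<in> gaps l \<Longrightarrow> nongaps l (Suc p) = nongaps l p"
  by (auto simp: nongaps_def less_Suc_eq)

lemma card_nongaps:
  assumes "l \<ge> 1" "((l - 1) choose 2) * l \<le> p"
  shows "card (nongaps l p) = p - ((l - 1) choose 2)"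
proof -
  have "gaps l \<subseteq> {..<p}" using assms gaps_less by fastforce
  then show ?thesis
    using assms by (simp add: nongaps_def card_Diff_subset finite_gaps card_gaps)
qed

lemma ordered_triple:
  fixes x y z :: nat
  assumes "x \<noteq> y" "x \<noteq> z" "y \<noteq> z"
  shows "\<exists>i j k. {x, y, z} = {i, j, k} \<and> i < j \<and> j < k"
proof -
  consider "x < y" "y < z" | "x < z" "z < y" | "y < x" "x < z" | "y < z" "z < x"
    | "z < x" "x < y" | "z < y" "y < x"
    using assms by linarith
  then show ?thesis
  proof cases
    case 1 then show ?thesis by blast
  next
    case 2 then show ?thesis by (intro exI[of _ x] exI[of _ z] exI[of _ y]) auto
  next
    case 3 then show ?thesis by (intro exI[of _ y] exI[of _ x] exI[of _ z]) auto
  next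
    case 4 then show ?thesis by (intro exI[of _ y] exI[of _ z] exI[of _ x]) auto
  next
    case 5 then show ?thesis by (intro exI[of _ z] exI[of _ x] exI[of _ y]) auto
  next
    case 6 then show ?thesis by (intro exI[of _ z] exI[of _ y] exI[of _ x]) auto
  qed
qed

locale triple_system =
  fixes l n :: nat and V :: "'a set" and Bs :: "'a set set"
  assumes psts: "partial_steiner_triple_system n V Bs" and l_pos: "l \<ge> 1"
begin

abbreviation m :: nat where "m \<equiv> (l - 1) choose 2"

definition block_free :: "nat set \<Rightarrow> (nat \<Rightarrow> 'a) \<Rightarrow> bool" where
  "block_free D f \<longleftrightarrow>
     (\<forall>i\<in>D. \<forall>j\<in>D. \<forall>k\<in>D. i < j \<longrightarrow> j < k \<longrightarrow> k < i + l \<longrightarrow> {f i, f j, f k} \<notin> Bs)"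

text \<open>The points that would complete a block if put at position \<open>p\<close> when the positions in \<open>D\<close> are
filled according to \<open>f\<close>. The position \<open>p\<close> may lie before, between or after positions of \<open>D\<close>, so
the same notion serves for the next position and for the gaps.\<close>

definition bad :: "nat set \<Rightarrow> (nat \<Rightarrow> 'a) \<Rightarrow> nat \<Rightarrow> 'a set" where
  "bad D f p = {x. \<exists>(i, j)\<in>near_pairs l p \<inter> D \<times> D. {x, f i, f j} \<in> Bs}"

text \<open>In a partial placement all positions below \<open>p\<close> except the gaps are filled; the values of \<open>f\<close>
elsewhere carry no information, so a placement is extended by function update.\<close>

definition placed :: "nat \<Rightarrow> (nat \<Rightarrow> 'a) \<Rightarrow> bool" where
  "placed p f \<longleftrightarrow> inj_on f (nongaps l p) \<and> f ` nongaps l p \<subseteq> V \<and> block_free (nongaps l p) f"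

lemma finite_V: "finite V" and card_V: "card V = n"
  using psts by (auto simp: partial_steiner_triple_system_def)

text \<open>Here the condition on intersections of blocks enters: two different blocks \<open>{x, a, b}\<close> and
\<open>{y, a, b}\<close> would share two points. For \<open>a = b\<close> the set is empty, as blocks have three
elements.\<close>

lemma card_third_points: "finite {x. {x, a, b} \<in> Bs} \<and> card {x. {x, a, b} \<in> Bs} \<le> 1"
proof -
  have "x = y" if "{x, a, b} \<in> Bs" "{y, a, b} \<in> Bs" for x y
  proof (rule ccontr)
    assume "x \<noteq> y"
    have "card {x, a, b} = 3" "card {y, a, b} = 3"
      using psts that by (auto simp: partial_steiner_triple_system_def)
    then have d: "a \<noteq> b" "x \<noteq> a" "x \<noteq> b" "y \<noteq> a" "y \<noteq> b"
      by (auto simp: card_insert_if split: if_splits)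
    then have "{x, a, b} \<noteq> {y, a, b}" using \<open>x \<noteq> y\<close> by auto
    then have "card ({x, a, b} \<inter> {y, a, b}) \<le> 1"
      using psts that by (auto simp: partial_steiner_triple_system_def)
    moreover have "card {a, b} \<le> card ({x, a, b} \<inter> {y, a, b})"
      by (rule card_mono) auto
    ultimately show False using d by simp
  qed
  then have "{x. {x, a, b} \<in> Bs} = {} \<or> (\<exists>z. {x. {x, a, b} \<in> Bs} = {z})" by blast
  then show ?thesis by auto
qed

lemma card_bad_le:
  assumes "near_pairs l p \<inter> D \<times> D \<subseteq> Q" "finite Q"
  shows "finite (bad D f p) \<and> card (bad D f p) \<le> card Q"
proof -
  let ?T = "\<Union>q\<in>Q. {x. {x, f (fst q), f (snd q)} \<in> Bs}"
  have sub: "bad D f p \<subseteq> ?T"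
  proof
    fix x assume "x \<in> bad D f p"
    then obtain i j where ij: "(i, j) \<in> near_pairs l p \<inter> D \<times> D" "{x, f i, f j} \<in> Bs"
      unfolding bad_def by blast
    then have "(i, j) \<in> Q" using assms(1) by blast
    then show "x \<in> ?T" using ij(2) by (intro UN_I[of "(i, j)"]) simp_all
  qed
  have fin: "finite ?T" using assms(2) card_third_points by blast
  have "card ?T \<le> (\<Sum>q\<in>Q. card {x. {x, f (fst q), f (snd q)} \<in> Bs})"
    using assms(2) by (rule card_UN_le)
  also have "\<dots> \<le> (\<Sum>q\<in>Q. 1)" using card_third_points by (intro sum_mono) blast
  finally have "card ?T \<le> card Q" by simp
  then show ?thesis using card_mono[OF fin sub] finite_subset[OF sub fin] by linarith
qed

lemma card_bad: "finite (bad D f p) \<and> card (bad D f p) \<le> 3 * m"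
  using card_bad_le[of p D "near_pairs l p" f] card_near_pairs[of l p] by auto

lemma card_bad_next:
  "finite (bad (nongaps l p) f p) \<and> card (bad (nongaps l p) f p) \<le> m"
proof -
  have "near_pairs l p \<inter> nongaps l p \<times> nongaps l p \<subseteq> near_pairs l p \<inter> {..<p} \<times> {..<p}"
    by (auto simp: nongaps_def)
  from card_bad_le[OF this, of f] near_pairs_before[of l p] show ?thesis by auto
qed

lemma block_free_insert:
  assumes bf: "block_free D f" and p: "p \<notin> D" and x: "x \<notin> bad D f p"
  shows "block_free (insert p D) (f(p := x))"
  unfolding block_free_def
proof (intro ballI impI)
  fix i j k
  assume D: "i \<in> insert p D" "j \<in> insert p D" "k \<in> insert p D" and ord: "i < j" "j < k" "k < i + l"
  have no: "{x, f a, f b} \<notin> Bs" if "a \<in> D" "b \<in> D" "(a, b) \<in> near_pairs l p" for a b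
    using x that by (auto simp: bad_def)
  consider "i = p" | "j = p" | "k = p" | "i \<noteq> p" "j \<noteq> p" "k \<noteq> p" by blast
  then show "{(f(p := x)) i, (f(p := x)) j, (f(p := x)) k} \<notin> Bs"
  proof cases
    case 1
    then have "{x, f j, f k} \<notin> Bs" using D ord by (intro no) (auto simp: near_pairs_def)
    then show ?thesis using 1 ord by simp
  next
    case 2
    then have "{x, f i, f k} \<notin> Bs" using D ord by (intro no) (auto simp: near_pairs_def)
    then show ?thesis using 2 ord by (simp add: insert_commute)
  next
    case 3
    then have "{x, f i, f j} \<notin> Bs" using D ord by (intro no) (auto simp: near_pairs_def)
    then show ?thesis using 3 ord by (simp add: insert_commute)
  next
    case 4
    then show ?thesis using bf D ord by (auto simp: block_free_def)
  qed
qed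

lemma placed_Suc:
  assumes "placed p f" "p \<notin> gaps l" "x \<in> V - f ` nongaps l p" "x \<notin> bad (nongaps l p) f p"
  shows "placed (Suc p) (f(p := x))"
proof -
  have p: "p \<notin> nongaps l p" by (simp add: nongaps_def)
  have img: "(f(p := x)) ` nongaps l p = f ` nongaps l p"
    using p by (intro image_cong) auto
  have "inj_on (f(p := x)) (nongaps l p)"
    using assms(1) p by (auto simp: placed_def inj_on_def)
  then show ?thesis
    using assms p img block_free_insert[OF _ p assms(4)]
    by (simp add: placed_def nongaps_Suc)
qed

text \<open>The greedy step. Besides the at most \<open>m\<close> bad points it can avoid a further set \<open>F\<close>, and the new
point can be required to come from any sufficiently large supply \<open>A\<close> of unused points.\<close>

lemma choose_next:
  assumes "placed p f" "p \<notin> gaps l" "A \<subseteq> V - f ` nongaps l p" "finite F" "m + card F < card A"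
  obtains x where "x \<in> A - F" "placed (Suc p) (f(p := x))"
proof -
  let ?X = "bad (nongaps l p) f p \<union> F"
  have "card ?X \<le> m + card F"
    using card_Un_le[of "bad (nongaps l p) f p" F] card_bad_next[of p f] by linarith
  moreover have "finite ?X" using card_bad_next assms(4) by blast
  ultimately have "\<not> A \<subseteq> ?X" using assms(5) card_mono[of ?X A] by linarith
  then obtain x where "x \<in> A" "x \<notin> ?X" by blast
  then show thesis using that placed_Suc[OF assms(1,2)] assms(3) by blast
qed

section \<open>Filling the positions outside the gaps\<close>

lemma placed_prefix:
  assumes "m * l + m \<le> n" "p \<le> m * l"
  shows "\<exists>f. placed p f"
  using assms(2)
proof (induction p)
  case 0
  show ?case by (simp add: placed_def nongaps_def block_free_def)
next
  case (Suc p)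
  then obtain f where f: "placed p f" by auto
  show ?case
  proof (cases "p \<in> gaps l")
    case True
    then show ?thesis using f by (auto simp: placed_def nongaps_Suc_gap)
  next
    case False
    have "card (f ` nongaps l p) \<le> card (nongaps l p)" by (rule card_image_le[OF finite_nongaps])
    also have "\<dots> \<le> card {..<p}" by (rule card_mono) (auto simp: nongaps_def)
    finally have "card (f ` nongaps l p) \<le> p" by simp
    moreover have "card V - card (f ` nongaps l p) \<le> card (V - f ` nongaps l p)"
      by (rule diff_card_le_card_Diff) (simp add: finite_nongaps)
    ultimately have "m + card ({} :: 'a set) < card (V - f ` nongaps l p)"
      using assms(1) Suc.prems card_V by simp
    from choose_next[OF f False order_refl _ this] show ?thesis by auto
  qed
qed

text \<open>As long as \<open>q < n\<close>, more than \<open>m\<close> points are unused, because the \<open>m\<close> gaps are still empty.\<close>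

lemma placed_completion:
  assumes "placed p f" "m * l \<le> p" "p \<le> q" "q \<le> n"
  shows "\<exists>f'. placed q f' \<and> (\<forall>i<p. f' i = f i)"
  using assms(3,4)
proof (induction q rule: dec_induct)
  case base
  show ?case using assms(1) by blast
next
  case (step q)
  then obtain f' where f': "placed q f'" "\<forall>i<p. f' i = f i" by auto
  have q: "q \<notin> gaps l" using gaps_less[OF l_pos] assms(2) step.hyps by fastforce
  have "m \<le> m * l" using l_pos by simp
  then have "m \<le> q" using assms(2) step.hyps by linarith
  have "card (nongaps l q) = q - m" 
    using card_nongaps[OF l_pos] assms(2) step.hyps by simp
  then have "card (f' ` nongaps l q) \<le> q - m"
    using card_image_le[OF finite_nongaps] by metis
  moreover have "card V - card (f' ` nongaps l q) \<le> card (V - f' ` nongaps l q)"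
    by (rule diff_card_le_card_Diff) (simp add: finite_nongaps)
  ultimately have "m + card ({} :: 'a set) < card (V - f' ` nongaps l q)"
    using step.prems \<open>m \<le> q\<close> card_V by simp
  from choose_next[OF f'(1) q order_refl _ this] obtain x where "placed (Suc q) (f'(q := x))"
    by auto
  then show ?case using f'(2) step.hyps by (intro exI[of _ "f'(q := x)"]) (simp del: fun_upd_apply, simp)
qed

lemma nongaps_add:
  assumes "m * l \<le> p"
  shows "nongaps l (p + t) = nongaps l p \<union> {p..<p + t}"
  using gaps_less[OF l_pos] assms by (fastforce simp: nongaps_def)

text \<open>Preparation for placing \<open>b\<close>: the next \<open>t\<close> positions are filled from \<open>N\<close> in such a way that no two
of the new points lie in a block with \<open>b\<close>. Each new point rules out at most one further point, so step
number \<open>t\<close> has to avoid at most \<open>t\<close> points in addition to the bad ones, and \<open>t\<close> points of \<open>N\<close> are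
already used; this is the reason for the factor 2.\<close>

lemma fill_avoiding:
  assumes f: "placed p f" and p: "m * l \<le> p"
    and N: "N \<subseteq> V - f ` nongaps l p" "m + 2 * t \<le> card N"
  shows "\<exists>f'. placed (p + t) f' \<and> (\<forall>i<p. f' i = f i) \<and> f' ` {p..<p + t} \<subseteq> N \<and>
     (\<forall>i j. p \<le> i \<longrightarrow> i < j \<longrightarrow> j < p + t \<longrightarrow> {b, f' i, f' j} \<notin> Bs)"
  using N(2)
proof (induction t)
  case 0
  show ?case using f by (intro exI[of _ f]) auto
next
  case (Suc t)
  then obtain f' where f': "placed (p + t) f'" "\<forall>i<p. f' i = f i" "f' ` {p..<p + t} \<subseteq> N"
      "\<forall>i j. p \<le> i \<longrightarrow> i < j \<longrightarrow> j < p + t \<longrightarrow> {b, f' i, f' j} \<notin> Bs"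
    by auto
  define A where "A = N - f' ` {p..<p + t}"
  define F where "F = (\<Union>i\<in>{p..<p + t}. {x. {x, b, f' i} \<in> Bs})"
  have gap: "p + t \<notin> gaps l" using gaps_less[OF l_pos] p by fastforce
  have old: "f' ` nongaps l p = f ` nongaps l p"
    using f'(2) by (intro image_cong) (auto simp: nongaps_def)
  have A: "A \<subseteq> V - f' ` nongaps l (p + t)"
    using N(1) by (auto simp: A_def nongaps_add[OF p] image_Un old)
  have "card (f' ` {p..<p + t}) \<le> t"
    using card_image_le[of "{p..<p + t}" f'] by simp
  moreover have "card N - card (f' ` {p..<p + t}) \<le> card A"
    unfolding A_def by (rule diff_card_le_card_Diff) simp
  ultimately have cA: "card N \<le> card A + t" by linarith
  have finF: "finite F" using card_third_points by (simp add: F_def)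
  have "card F \<le> (\<Sum>i\<in>{p..<p + t}. card {x. {x, b, f' i} \<in> Bs})"
    unfolding F_def by (rule card_UN_le) simp
  also have "\<dots> \<le> (\<Sum>i\<in>{p..<p + t}. 1)" using card_third_points by (intro sum_mono) blast
  finally have "card F \<le> t" by simp
  then have "m + card F < card A" using cA Suc.prems by simp
  from choose_next[OF f'(1) gap A finF this] obtain x
    where x: "x \<in> A - F" "placed (Suc (p + t)) (f'(p + t := x))" by blast
  let ?g = "f'(p + t := x)"
  have "?g ` {p..<p + Suc t} \<subseteq> N"
    using x(1) f'(3) by (auto simp: A_def less_Suc_eq)
  moreover have "{b, ?g i, ?g j} \<notin> Bs" if "p \<le> i" "i < j" "j < p + Suc t" for i j
  proof (cases "j = p + t")
    case True
    then have "{x, b, f' i} \<notin> Bs" using x(1) that by (auto simp: F_def)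
    moreover have "{b, f' i, x} = {x, b, f' i}" by blast
    ultimately show ?thesis using True that by simp
  next
    case False
    then show ?thesis using f'(4) that by simp
  qed
  moreover have "\<forall>i<p. ?g i = f i" using f'(2) by simp
  ultimately show ?case
    using x(2) by (intro exI[of _ ?g]) (auto simp del: fun_upd_apply)
qed

text \<open>All points of \<open>U\<close> can be placed using \<open>N\<close> as a supply of fillers. The minimum in the hypothesis
reflects the two regimes: while \<open>U\<close> has more than \<open>m\<close> points, no fillers are spent; each of the last
\<open>m\<close> points may cost \<open>l - 1\<close> of them. The summand \<open>m + l\<close> keeps the supply sufficient for every
filling step and leaves at least \<open>m\<close> points at the end.\<close>

lemma absorb:
  assumes "placed p f" "m * l \<le> p"
    and "U \<subseteq> V - f ` nongaps l p" "N \<subseteq> V - f ` nongaps l p" "U \<inter> N = {}"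
    and "min (card U) m * (l - 1) + m + l \<le> card N"
  shows "\<exists>p' f'. p \<le> p' \<and> placed p' f' \<and> (\<forall>i<p. f' i = f i) \<and>
     U \<subseteq> f' ` nongaps l p' \<and> m \<le> card (V - f' ` nongaps l p')"
  using assms
proof (induction "card U" arbitrary: p f U N)
  case 0
  have "finite U" using "0.prems"(3) finite_V by (meson finite_Diff finite_subset)
  then have "U = {}" using 0 by simp
  have "card N \<le> card (V - f ` nongaps l p)"
    using "0.prems"(4) finite_V by (intro card_mono) auto
  then have "m \<le> card (V - f ` nongaps l p)" using "0.prems"(6) by linarith
  then show ?case using "0.prems"(1) \<open>U = {}\<close> by (intro exI[of _ p] exI[of _ f]) simp
next
  case (Suc u)
  have finU: "finite U" using Suc.prems(3) finite_V by (meson finite_Diff finite_subset)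
  \<comment> \<open>One point \<open>x\<close> of \<open>U\<close> goes to position \<open>q\<close>, after fillers from \<open>N\<close> at positions \<open>{p..<q}\<close>.\<close>
  have step: "\<exists>q g x N'. p \<le> q \<and> x \<in> U \<and> placed (Suc q) g \<and> (\<forall>i<p. g i = f i) \<and>
      g q = x \<and> g ` {p..<q} \<subseteq> N \<and> N' = N - g ` {p..<q} \<and>
      min u m * (l - 1) + m + l \<le> card N'"
  proof (cases "m < card U")
    case True
    have gap: "p \<notin> gaps l" using gaps_less[OF l_pos] Suc.prems(2) by fastforce
    obtain x where x: "x \<in> U" "placed (Suc p) (f(p := x))"
      using choose_next[OF Suc.prems(1) gap Suc.prems(3), of "{}"] True by auto
    have "min u m = min (card U) m" using True Suc.hyps(2) by linarith
    then have "min u m * (l - 1) + m + l \<le> card N" using Suc.prems(6) by simp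
    then show ?thesis using x
      by (intro exI[of _ p] exI[of _ "f(p := x)"] exI[of _ x] exI[of _ N]) simp
  next
    case False
    obtain b where b: "b \<in> U" using Suc.hyps(2) by fastforce
    have mins: "min (card U) m = Suc u" "min u m = u" using False Suc.hyps(2) by linarith+
    have cN: "u * (l - 1) + (l - 1) + m + l \<le> card N" using Suc.prems(6) mins by simp
    then have "m + 2 * (l - 1) \<le> card N" by linarith
    from fill_avoiding[OF Suc.prems(1,2,4) this, of b] obtain g where g:
      "placed (p + (l - 1)) g" "\<forall>i<p. g i = f i" "g ` {p..<p + (l - 1)} \<subseteq> N"
      "\<forall>i j. p \<le> i \<longrightarrow> i < j \<longrightarrow> j < p + (l - 1) \<longrightarrow> {b, g i, g j} \<notin> Bs" by blast
    let ?q = "p + (l - 1)"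
    have gap: "?q \<notin> gaps l" using gaps_less[OF l_pos] Suc.prems(2) by fastforce
    have old: "g ` nongaps l p = f ` nongaps l p"
      using g(2) by (intro image_cong) (auto simp: nongaps_def)
    have "b \<in> V - g ` nongaps l ?q"
      using b Suc.prems(3,5) g(3) by (auto simp: nongaps_add[OF Suc.prems(2)] image_Un old)
    \<comment> \<open>Every position at distance less than \<open>l\<close> before \<open>?q\<close> holds one of the fillers.\<close>
    moreover have "b \<notin> bad (nongaps l ?q) g ?q"
      using g(4) l_pos by (auto simp: bad_def near_pairs_def nongaps_def)
    ultimately have pl: "placed (Suc ?q) (g(?q := b))" using placed_Suc[OF g(1) gap] by blast
    have img: "(g(?q := b)) ` {p..<?q} = g ` {p..<?q}" by (intro image_cong) auto
    have "card (g ` {p..<?q}) \<le> l - 1" using card_image_le[of "{p..<?q}" g] by simp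
    moreover have "card N - card (g ` {p..<?q}) \<le> card (N - g ` {p..<?q})"
      by (rule diff_card_le_card_Diff) simp
    ultimately have "card N \<le> card (N - g ` {p..<?q}) + (l - 1)" by linarith
    then have "min u m * (l - 1) + m + l \<le> card (N - g ` {p..<?q})"
      unfolding mins(2) using cN by linarith
    then show ?thesis using pl b img g(2,3)
      by (intro exI[of _ ?q] exI[of _ "g(?q := b)"] exI[of _ b] exI[of _ "N - g ` {p..<?q}"]) simp
  qed
  then obtain q g x N' where q: "p \<le> q" "x \<in> U" "placed (Suc q) g" "\<forall>i<p. g i = f i" "g q = x"
      "g ` {p..<q} \<subseteq> N" "N' = N - g ` {p..<q}" "min u m * (l - 1) + m + l \<le> card N'" by blast
  have old: "g ` nongaps l p = f ` nongaps l p"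
    using q(4) by (intro image_cong) (auto simp: nongaps_def)
  have "{p..<Suc q} = insert q {p..<q}" using q(1) by auto
  then have img: "g ` nongaps l (Suc q) = f ` nongaps l p \<union> g ` {p..<q} \<union> {x}"
    using nongaps_add[OF Suc.prems(2), of "Suc q - p"] q(1,5) by (simp add: image_Un old)
  have cU: "u = card (U - {x})" using Suc.hyps(2) q(2) finU by simp
  have "\<exists>p' f'. Suc q \<le> p' \<and> placed p' f' \<and> (\<forall>i<Suc q. f' i = g i) \<and>
     U - {x} \<subseteq> f' ` nongaps l p' \<and> m \<le> card (V - f' ` nongaps l p')"
  proof (rule Suc.hyps(1)[OF cU q(3)])
    show "m * l \<le> Suc q" using Suc.prems(2) q(1) by simp
    show "U - {x} \<subseteq> V - g ` nongaps l (Suc q)" using Suc.prems(3,5) q(6) unfolding img by blast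
    show "N' \<subseteq> V - g ` nongaps l (Suc q)" using Suc.prems(4,5) q(2,7) unfolding img by blast
    show "(U - {x}) \<inter> N' = {}" using Suc.prems(5) q(7) by blast
    show "min (card (U - {x})) m * (l - 1) + m + l \<le> card N'" using q(8) cU by simp
  qed
  then obtain p' f' where p': "Suc q \<le> p'" "placed p' f'" "\<forall>i<Suc q. f' i = g i"
     "U - {x} \<subseteq> f' ` nongaps l p'" "m \<le> card (V - f' ` nongaps l p')" by blast
  have "q \<in> nongaps l p'"
    using p'(1) q(1) Suc.prems(2) gaps_less[OF l_pos] by (fastforce simp: nongaps_def)
  moreover have "f' q = x" using p'(3) q(5) by simp
  ultimately have "U \<subseteq> f' ` nongaps l p'" using p'(4) by blast
  moreover have "\<forall>i<p. f' i = f i" using p'(3) q(1,4) by simp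
  ultimately show ?case using p' q(1) by (intro exI[of _ p'] exI[of _ f']) simp
qed

text \<open>The set \<open>B\<close> is computed from a placement \<open>f0\<close> of the positions below \<open>m l\<close> only. All later
steps preserve \<open>f0\<close> there, and no gap has a nearby position at or beyond \<open>m l\<close>, so \<open>B\<close> still
contains the bad points of the gaps in the final placement.\<close>

lemma exists_gap_safe_placement:
  assumes n: "(2 * l + 3 * m) * m + l \<le> n"
  shows "\<exists>f. placed n f \<and> (\<forall>g\<in>gaps l. bad (nongaps l n) f g \<inter> V \<subseteq> f ` nongaps l n)"
proof -
  have n': "2 * (m * l) + 3 * (m * m) + l \<le> n" using n by (simp add: algebra_simps)
  have ml: "m \<le> m * l" using l_pos by simp
  have mln: "m * l + m \<le> n" using n' ml by linarith
  from placed_prefix[OF this order_refl] obtain f0 where f0: "placed (m * l) f0" by blast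
  define D where "D = nongaps l (m * l)"
  define B where "B = (\<Union>g\<in>gaps l. bad D f0 g)"
  have finB: "finite B" using card_bad finite_gaps by (simp add: B_def)
  have "card B \<le> (\<Sum>g\<in>gaps l. card (bad D f0 g))"
    unfolding B_def by (rule card_UN_le[OF finite_gaps])
  also have "\<dots> \<le> (\<Sum>g\<in>gaps l. 3 * m)" using card_bad by (intro sum_mono) blast
  finally have cB: "card B \<le> 3 * (m * m)" by (simp add: card_gaps[OF l_pos])
  have "card (f0 ` D) \<le> card D" by (rule card_image_le) (simp add: D_def finite_nongaps)
  then have cD: "card (f0 ` D) \<le> m * l - m" using card_nongaps[OF l_pos order_refl] by (simp add: D_def)
  define N where "N = V - (f0 ` D \<union> B)"
  have "card V - card (f0 ` D \<union> B) \<le> card N"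
    unfolding N_def by (rule diff_card_le_card_Diff) (simp add: D_def finite_nongaps finB)
  then have cN: "m * l + m + l \<le> card N"
    using card_Un_le[of "f0 ` D" B] cB cD n' card_V ml by linarith
  have "min (card (B \<inter> V - f0 ` D)) m * (l - 1) \<le> m * l" by (intro mult_le_mono) auto
  then have "min (card (B \<inter> V - f0 ` D)) m * (l - 1) + m + l \<le> card N"
    using cN by linarith
  then obtain p f1 where f1: "m * l \<le> p" "placed p f1" "\<forall>i<m * l. f1 i = f0 i"
     "B \<inter> V - f0 ` D \<subseteq> f1 ` nongaps l p" "m \<le> card (V - f1 ` nongaps l p)"
    using absorb[OF f0 order_refl, of "B \<inter> V - f0 ` D" N] unfolding N_def D_def by blast
  \<comment> \<open>At least \<open>m\<close> points are unused after absorbing \<open>B\<close>, so the positions reached do not exceed \<open>n\<close>.\<close>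
  have "card (f1 ` nongaps l p) = p - m"
    using f1(2) card_nongaps[OF l_pos f1(1)] by (simp add: placed_def card_image)
  moreover have "card (V - f1 ` nongaps l p) = n - card (f1 ` nongaps l p)"
    using f1(2) card_V by (simp add: placed_def card_Diff_subset finite_nongaps)
  moreover have "card (f1 ` nongaps l p) \<le> n"
    using f1(2) card_mono[OF finite_V] card_V by (auto simp: placed_def)
  ultimately have "p \<le> n" using f1(5) mln by linarith
  from placed_completion[OF f1(2,1) this order_refl] obtain f
    where f: "placed n f" "\<forall>i<p. f i = f1 i" by blast
  have f_f0: "f i = f0 i" if "i < m * l" for i using that f(2) f1(1,3) by simp
  have bad_eq: "bad (nongaps l n) f g \<subseteq> bad D f0 g" if "g \<in> gaps l" for g
  proof
    fix x assume "x \<in> bad (nongaps l n) f g"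
    then obtain i j where ij: "(i, j) \<in> near_pairs l g" "i \<in> nongaps l n" "j \<in> nongaps l n"
      "{x, f i, f j} \<in> Bs" by (auto simp: bad_def)
    then have "i < m * l" "j < m * l" using gap_window[OF that] by (auto simp: near_pairs_def)
    then have "{x, f0 i, f0 j} \<in> Bs" "i \<in> D" "j \<in> D"
      using ij f_f0 by (auto simp: D_def nongaps_def)
    then show "x \<in> bad D f0 g" using ij(1) by (auto simp: bad_def)
  qed
  have "f0 ` D = f ` D" using f_f0 by (intro image_cong) (auto simp: D_def nongaps_def)
  moreover have "D \<subseteq> nongaps l n" using mln by (auto simp: D_def nongaps_def)
  ultimately have "f0 ` D \<subseteq> f ` nongaps l n" by auto
  moreover have "f1 ` nongaps l p = f ` nongaps l p"
    using f(2) by (intro image_cong) (auto simp: nongaps_def)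
  moreover have "nongaps l p \<subseteq> nongaps l n" using \<open>p \<le> n\<close> by (auto simp: nongaps_def)
  ultimately have "f0 ` D \<subseteq> f ` nongaps l n" "f1 ` nongaps l p \<subseteq> f ` nongaps l n" by auto
  with f1(4) have B_placed: "x \<in> f ` nongaps l n" if "x \<in> B" "x \<in> V" for x
    using that by (meson DiffI IntI subsetD)
  have "bad (nongaps l n) f g \<inter> V \<subseteq> f ` nongaps l n" if "g \<in> gaps l" for g
  proof
    fix x assume x: "x \<in> bad (nongaps l n) f g \<inter> V"
    then have "x \<in> B" using bad_eq[OF that] that unfolding B_def by blast
    then show "x \<in> f ` nongaps l n" using x B_placed by blast
  qed
  then show ?thesis using f(1) by blast
qed

section \<open>Filling the gaps\<close>

text \<open>A segment of length \<open>l\<close> meets at most one gap. A block in a segment without a gap is excluded by the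
placement, and one that uses a gap would make the point there bad for this gap.\<close>

lemma exists_block_free_bijection:
  assumes n: "(2 * l + 3 * m) * m + l \<le> n"
  shows "\<exists>F. bij_betw F {..<n} V \<and> block_free {..<n} F"
proof -
  obtain f where f: "placed n f"
    and safe: "\<forall>g\<in>gaps l. bad (nongaps l n) f g \<inter> V \<subseteq> f ` nongaps l n"
    using exists_gap_safe_placement[OF n] by blast
  define D where "D = nongaps l n"
  have mln: "m * l \<le> n" using n by (simp add: algebra_simps)
  have ml: "m \<le> m * l" using l_pos by simp
  have un: "{..<n} = D \<union> gaps l" "D \<inter> gaps l = {}"
    using gaps_less[OF l_pos] mln by (fastforce simp: D_def nongaps_def)+
  have inj: "inj_on f D" and sub: "f ` D \<subseteq> V" and bf: "block_free D f"
    using f by (auto simp: placed_def D_def)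
  have "m \<le> n" using ml mln by linarith
  then have "card (V - f ` D) = m"
    using inj sub card_V card_nongaps[OF l_pos mln]
    by (simp add: card_Diff_subset card_image D_def finite_nongaps)
  then obtain h where h: "bij_betw h (gaps l) (V - f ` D)"
    using finite_same_card_bij[OF finite_gaps, of "V - f ` D" l] finite_V card_gaps[OF l_pos] by auto
  define F where "F i = (if i \<in> D then f i else h i)" for i
  have "bij_betw F D (f ` D)"
    using inj by (auto simp: bij_betw_def F_def inj_on_def)
  moreover have "bij_betw F (gaps l) (V - f ` D)"
    using h un(2) by (subst bij_betw_cong[of _ F h]) (auto simp: F_def)
  ultimately have "bij_betw F (D \<union> gaps l) (f ` D \<union> (V - f ` D))"
    by (rule bij_betw_combine) blast
  then have bij: "bij_betw F {..<n} V" using sub un(1) by (simp add: Un_absorb1)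
  have no: "{F g, f a, f b} \<notin> Bs"
    if "g \<in> gaps l" "a \<in> D" "b \<in> D" "(a, b) \<in> near_pairs l g" for g a b
  proof
    assume "{F g, f a, f b} \<in> Bs"
    then have "F g \<in> bad D f g" using that by (auto simp: bad_def)
    moreover have "F g \<in> V - f ` D" using h un(2) that(1) by (auto simp: F_def bij_betw_def)
    ultimately show False using safe that(1) by (auto simp: D_def)
  qed
  have one: "b \<in> D" if "a \<in> gaps l" "b < n" "a < b + l" "b < a + l" "a \<noteq> b" for a b
  proof -
    have "b \<notin> gaps l"
      using that gaps_far_apart[of a l b] gaps_far_apart[of b l a] by linarith
    then show ?thesis using that(2) un(1) by blast
  qed
  have "block_free {..<n} F"
    unfolding block_free_def
  proof (intro ballI impI)
    fix i j k
    assume lt: "i \<in> {..<n}" "j \<in> {..<n}" "k \<in> {..<n}" and ord: "i < j" "j < k" "k < i + l"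
    consider "i \<in> gaps l" | "j \<in> gaps l" | "k \<in> gaps l" | "i \<in> D" "j \<in> D" "k \<in> D"
      using lt un(1) by blast
    then show "{F i, F j, F k} \<notin> Bs"
    proof cases
      case 1
      have D: "j \<in> D" "k \<in> D" using one[OF 1] lt ord by auto
      have "{F i, f j, f k} \<notin> Bs" using ord by (intro no[OF 1 D]) (auto simp: near_pairs_def)
      then show ?thesis using D by (simp add: F_def)
    next
      case 2
      have D: "i \<in> D" "k \<in> D" using one[OF 2] lt ord by auto
      have "{F j, f i, f k} \<notin> Bs" using ord by (intro no[OF 2 D]) (auto simp: near_pairs_def)
      then show ?thesis using D by (simp add: F_def insert_commute)
    next
      case 3
      have D: "i \<in> D" "j \<in> D" using one[OF 3] lt ord by auto
      have "{F k, f i, f j} \<notin> Bs" using ord by (intro no[OF 3 D]) (auto simp: near_pairs_def)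
      then show ?thesis using D by (simp add: F_def insert_commute)
    next
      case 4
      then show ?thesis using bf ord by (auto simp: F_def block_free_def)
    qed
  qed
  then show ?thesis using bij by blast
qed

text \<open>A block inside a segment consists of three points whose positions, listed in increasing order, span
less than \<open>l\<close>.\<close>

lemma good_sequencing_map:
  assumes bij: "bij_betw F {..<n} V" and bf: "block_free {..<n} F"
  shows "good_sequencing l V Bs (map F [0..<n])"
  unfolding good_sequencing_def
proof (intro conjI allI impI notI)
  show "sequencing V (map F [0..<n])"
    using bij by (auto simp: sequencing_def bij_betw_def distinct_map atLeast0LessThan)
next
  fix ys
  assume ys: "sublist ys (map F [0..<n]) \<and> length ys \<le> l" and "\<exists>B\<in>Bs. B \<subseteq> set ys"
  then obtain us vs B where eq: "map F [0..<n] = us @ ys @ vs" and B: "B \<in> Bs" "B \<subseteq> set ys"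
    by (auto simp: sublist_def)
  let ?a = "length us"
  have len: "n = ?a + length ys + length vs" using arg_cong[OF eq, of length] by simp
  have "F ` {?a..<?a + length ys} \<supseteq> set ys"
  proof
    fix y assume "y \<in> set ys"
    then obtain t where t: "t < length ys" "y = ys ! t" by (auto simp: in_set_conv_nth)
    then have "map F [0..<n] ! (?a + t) = y" by (simp add: eq nth_append)
    then have "y = F (?a + t)" using t(1) len by simp
    then show "y \<in> F ` {?a..<?a + length ys}" using t(1) by simp
  qed
  then obtain T where T: "T \<subseteq> {?a..<?a + length ys}" "B = F ` T"
    using B(2) by (meson subset_imageE subset_trans)
  have "T \<subseteq> {..<n}" using T(1) len by auto
  then have "inj_on F T" using bij by (auto simp: bij_betw_def intro: inj_on_subset)
  then have "card T = 3"
    using psts B(1) T(2) by (metis card_image partial_steiner_triple_system_def)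
  then obtain x y z where "T = {x, y, z}" "x \<noteq> y" "x \<noteq> z" "y \<noteq> z" by (auto simp: card_3_iff)
  then have "\<exists>i j k. T = {i, j, k} \<and> i < j \<and> j < k"
    using ordered_triple by simp
  then obtain i j k where ijk: "T = {i, j, k}" "i < j" "j < k" by blast
  then have "k < i + l" "i < n" "j < n" "k < n" using T(1) ys len by auto
  then have "{F i, F j, F k} \<notin> Bs" using bf ijk by (simp add: block_free_def)
  then show False using B(1) T(2) ijk(1) by simp
qed

end

section \<open>Size of the bound\<close>

lemma real_choose_two: "l \<ge> 1 \<Longrightarrow> real ((l - 1) choose 2) = (real l - 1) * (real l - 2) / 2"
  by (cases l) (auto simp: choose_two real_of_nat_div algebra_simps)

lemma bound_asymptotics:
  "(\<lambda>l :: nat. real ((2 * l + 3 * ((l - 1) choose 2)) * ((l - 1) choose 2) + l)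
        - 3 / 4 * real l ^ 4) \<in> O(\<lambda>l. real l ^ 3)"
proof -
  let ?c = "\<lambda>l::nat. (real l - 1) * (real l - 2) / 2"
  have "\<forall>\<^sub>F l in at_top. real ((2 * l + 3 * ((l - 1) choose 2)) * ((l - 1) choose 2) + l)
        - 3 / 4 * real l ^ 4 = (2 * real l + 3 * ?c l) * ?c l + real l - 3 / 4 * real l ^ 4"
    using eventually_ge_at_top[of 1]
    by eventually_elim (simp only: of_nat_add of_nat_mult of_nat_numeral real_choose_two)
  moreover have "(\<lambda>l. (2 * real l + 3 * ?c l) * ?c l + real l - 3 / 4 * real l ^ 4)
      \<in> O(\<lambda>l. real l ^ 3)"
    by real_asymp
  ultimately show ?thesis by (subst landau_o.big.in_cong)
qed

theorem theorem1:
  "(\<forall>l n :: nat. l \<ge> 1 \<longrightarrow>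
       n \<ge> (2 * l + 3 * ((l - 1) choose 2)) * ((l - 1) choose 2) + l \<longrightarrow>
       (\<forall>(V :: 'a set) Bs. partial_steiner_triple_system n V Bs \<longrightarrow>
          (\<exists>xs. good_sequencing l V Bs xs))) \<and>
   (\<lambda>l :: nat. real ((2 * l + 3 * ((l - 1) choose 2)) * ((l - 1) choose 2) + l)
        - 3 / 4 * real l ^ 4) \<in> O(\<lambda>l. real l ^ 3)"
proof (intro conjI allI impI)
  fix l n :: nat and V :: "'a set" and Bs
  assume "l \<ge> 1" and n: "n \<ge> (2 * l + 3 * ((l - 1) choose 2)) * ((l - 1) choose 2) + l"
    and "partial_steiner_triple_system n V Bs"
  then interpret triple_system l n V Bs by unfold_locales
  show "\<exists>xs. good_sequencing l V Bs xs"
    using exists_block_free_bijection[OF n] good_sequencing_map by blast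
qed (rule bound_asymptotics)

end
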